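(* Let $G$ be a locally compact group, $K$ a compact subgroup with normalized Haar measure $dk$, and $\mu:G\to\mathbb{C}\setminus\{0\}$ a continuous character. Let $f,g\in\mathcal{C}(G)$ satisfy $$\int_K f(xkyk^{-1})\,dk+\mu(y)\int_K f(xky^{-1}k^{-1})\,dk=2f(x)g(y)\quad\text{for all } x,y\in G,$$ and assume $C_Kf\neq 0$. Then $g$ satisfies $$\int_K g(xkyk^{-1})\,dk+\mu(y)\int_K g(xky^{-1}k^{-1})\,dk=2g(x)g(y)\quad\text{for all } x,y\in G.$$
   Context: $\mathcal{C}(G)$ is the space of complex continuous functions on $G$. A character of $G$ is a homomorphism $G\to\mathbb{C}\setminus\{0\}$. The operator $C_K$ is $(C_Kf)(x)=\int_K f(kxk^{-1})\,dk$. *)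

theory Defs
  imports "HOL-Analysis.Analysis"
begin

text \<open>Groups are written additively (type class group_add, not necessarily commutative):
  the product x y is x + y, the inverse y^-1 is - y, the identity is 0.\<close>

definition compact_subgroup :: "'g::topological_group_add set \<Rightarrow> bool" where
  "compact_subgroup K \<longleftrightarrow> compact K \<and> 0 \<in> K \<and>
     (\<forall>a\<in>K. \<forall>b\<in>K. a + b \<in> K) \<and> (\<forall>a\<in>K. - a \<in> K)"

definition normalized_haar :: "'g::topological_group_add set \<Rightarrow> 'g measure \<Rightarrow> bool" where
  "normalized_haar K M \<longleftrightarrow> space M = K \<and> emeasure M K = 1 \<and>
     sets M = sets (restrict_space borel K) \<and>
     (\<forall>k\<in>K. \<forall>A\<in>sets M. emeasure M ((\<lambda>x. k + x) ` A) = emeasure M A) \<and>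
     (\<forall>k\<in>K. \<forall>A\<in>sets M. emeasure M ((\<lambda>x. x + k) ` A) = emeasure M A)"

definition continuous_character :: "('g::topological_group_add \<Rightarrow> complex) \<Rightarrow> bool" where
  "continuous_character \<mu> \<longleftrightarrow> continuous_on UNIV \<mu> \<and> (\<forall>x. \<mu> x \<noteq> 0) \<and>
     (\<forall>x y. \<mu> (x + y) = \<mu> x * \<mu> y)"

definition C_op :: "'g::topological_group_add measure \<Rightarrow> ('g \<Rightarrow> complex) \<Rightarrow> 'g \<Rightarrow> complex" where
  "C_op M f x = (\<integral>k. f (k + x + - k) \<partial>M)"

end

theory Submission
  imports Defs "HOL-Probability.Probability_Measure"
begin

text \<open>Write \<open>p(x \<star> y)\<close> for the average of \<open>p(x k y k\<^sup>-\<^sup>1)\<close> over \<open>K\<close>. The product \<open>\<star>\<close> is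
  associative, and inversion reverses it on functions invariant under conjugation by \<open>K\<close>. Hence
  every left translate \<open>f(w \<star> \<cdot>)\<close> of a solution solves the equation again with the same \<open>g\<close>;
  as \<open>C\<^sub>K f = f(e \<star> \<cdot>)\<close> is nonzero at some \<open>w\<close>, its translate \<open>q\<close> by \<open>w\<close> is an invariant
  solution with \<open>q(e) \<noteq> 0\<close>. Let \<open>D(x, y) = g(x \<star> y) + \<mu>(y) g(x \<star> y\<^sup>-\<^sup>1) - 2 g(x) g(y)\<close>. Combining
  the equation at \<open>x \<star> y\<close> and at \<open>x \<star> y\<^sup>-\<^sup>1\<close> gives
  \<open>q(y \<star> x) + \<mu>(y) q(y\<^sup>-\<^sup>1 \<star> x) - 2 g(y) q(x) = - 2 q(e) D(x, y)\<close>, so \<open>h = D(\<cdot>, y)\<close> is a linear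
  combination of solutions, thus itself a solution, and it is odd: \<open>\<mu>(x) h(x\<^sup>-\<^sup>1) = - h(x)\<close>. The
  same identity for the translates of \<open>h\<close>, compared with its image under inversion, yields
  \<open>h(x) D(x, y) = - h(x) D(x, y)\<close>, that is \<open>h(x)\<^sup>2 = 0\<close>.\<close>

lemmas group_norm = add.assoc minus_add

section \<open>Invariant integration over the compact group \<open>K\<close>\<close>

locale compact_haar =
  fixes K :: "'g::{topological_group_add, t2_space} set" and M :: "'g measure"
  assumes subgroup: "compact_subgroup K" and haar: "normalized_haar K M"
begin

lemma compact_K: "compact K"
  and zero_in_K: "0 \<in> K"
  and add_in_K: "a \<in> K \<Longrightarrow> b \<in> K \<Longrightarrow> a + b \<in> K"
  and minus_in_K: "a \<in> K \<Longrightarrow> - a \<in> K"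
  using subgroup by (auto simp: compact_subgroup_def)

lemma space_M: "space M = K"
  and sets_M: "sets M = sets (restrict_space borel K)"
  using haar by (auto simp: normalized_haar_def)

sublocale prob_space M
  using haar by (intro prob_spaceI) (simp add: normalized_haar_def)

sublocale pair: pair_prob_space M M ..

lemma continuous_measurable:
  fixes p :: "'g \<Rightarrow> 'b::topological_space"
  assumes "continuous_on UNIV p"
  shows "p \<in> borel_measurable M"
  using borel_measurable_continuous_on_restrict[OF continuous_on_subset[OF assms subset_UNIV, of K]]
  by (simp add: measurable_cong_sets[OF sets_M refl])

lemma continuous_integrable:
  fixes p :: "'g \<Rightarrow> complex"
  assumes "continuous_on UNIV p"
  shows "integrable M p"
proof -
  have "bounded (p ` K)"
    by (intro compact_imp_bounded compact_continuous_image compact_K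
        continuous_on_subset[OF assms subset_UNIV])
  then obtain B where "\<And>k. k \<in> K \<Longrightarrow> norm (p k) \<le> B"
    by (auto simp: bounded_iff)
  then show ?thesis
    by (intro integrable_const_bound[where B = B] continuous_measurable assms)
       (auto simp: space_M)
qed

text \<open>The preimage of a measurable set under \<open>t\<close> is its image under
  \<open>s\<close>, so \<open>inv\<close> says that \<open>t\<close> pushes \<open>M\<close> forward
  to itself.\<close>

lemma integral_bij:
  fixes p :: "'g \<Rightarrow> complex"
  assumes p: "continuous_on UNIV p" and t: "continuous_on UNIV t" 
    and tK: "t ` K \<subseteq> K" and sK: "s ` K \<subseteq> K"
    and ts: "\<And>x. t (s x) = x" and st: "\<And>x. s (t x) = x"
    and inv: "\<And>A. A \<in> sets M \<Longrightarrow> emeasure M (s ` A) = emeasure M A"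
  shows "(\<integral>k. p (t k) \<partial>M) = (\<integral>k. p k \<partial>M)"
proof -
  have meas: "t \<in> measurable M M"
    using continuous_measurable[OF t] tK
    by (auto simp: measurable_cong_sets[OF refl sets_M] space_M intro!: measurable_restrict_space2)
  have "distr M M t = M"
  proof (rule measure_eqI)
    fix A assume "A \<in> sets (distr M M t)"
    then have A: "A \<in> sets M" by simp
    then have "A \<subseteq> K" using sets.sets_into_space space_M by auto
    then have "t -` A \<inter> K = s ` A"
      using sK ts st by (auto simp: image_iff) (metis st)
    then show "emeasure (distr M M t) A = emeasure M A"
      using A inv by (simp add: emeasure_distr[OF meas] space_M)
  qed simp
  then show ?thesis
    using integral_distr[OF meas continuous_measurable[OF p]] by simp
qed

lemma integral_left_shift:
  fixes p :: "'g \<Rightarrow> complex"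
  assumes "continuous_on UNIV p" "a \<in> K"
  shows "(\<integral>k. p (a + k) \<partial>M) = (\<integral>k. p k \<partial>M)"
  using haar assms add_in_K minus_in_K
  by (intro integral_bij[where s = "\<lambda>x. - a + x"] continuous_intros)
     (auto simp: normalized_haar_def simp flip: add.assoc)

lemma integral_right_shift:
  fixes p :: "'g \<Rightarrow> complex"
  assumes "continuous_on UNIV p" "a \<in> K"
  shows "(\<integral>k. p (k + a) \<partial>M) = (\<integral>k. p k \<partial>M)"
  using haar assms add_in_K minus_in_K
  by (intro integral_bij[where s = "\<lambda>x. x + - a"] continuous_intros)
     (auto simp: normalized_haar_def add.assoc simp del: add_uminus_conv_diff)

section \<open>Double integrals, parameter integrals and inversion on \<open>K\<close>\<close>

lemma continuous_slice:
  fixes q :: "'a::topological_space \<Rightarrow> 'g \<Rightarrow> complex"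
  assumes q: "continuous_on UNIV (\<lambda>z. q (fst z) (snd z))"
  shows "continuous_on UNIV (q x)"
proof -
  have "continuous_on UNIV (\<lambda>y. q (fst (x, y)) (snd (x, y)))"
    by (rule continuous_on_compose2[OF q], rule continuous_on_Pair,
        rule continuous_on_const, rule continuous_on_id, simp)
  then show ?thesis by simp
qed

text \<open>Compactness of \<open>K\<close> makes the neighbourhood of \<open>a\<close> independent
  of \<open>t\<close>. Both product measurability and continuity of parameter integrals rest on this
  estimate.\<close>

lemma uniform_slices:
  fixes q :: "'a::topological_space \<Rightarrow> 'g \<Rightarrow> complex"
  assumes q: "continuous_on UNIV (\<lambda>z. q (fst z) (snd z))" and "e > 0"
  shows "\<exists>X. a \<in> X \<and> open X \<and> (\<forall>x\<in>X. \<forall>t\<in>K. dist (q x t) (q a t) \<le> e)"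
proof -
  have "continuous_on (UNIV \<times> K) (\<lambda>z. q (fst z) (snd z))"
    by (rule continuous_on_subset[OF q]) simp
  from continuous_on_prod_compactE[OF this compact_K UNIV_I[of a] \<open>e > 0\<close>]
  obtain X where "a \<in> X" "open X"
    "\<forall>x \<in> X \<inter> UNIV. \<forall>t \<in> K. dist (q (fst (x, t)) (snd (x, t))) (q (fst (a, t)) (snd (a, t))) \<le> e"
    by blast
  then show ?thesis by auto
qed

text \<open>\<open>K\<close> need not be second countable, so continuity does not give measurability with
  respect to the product sigma-algebra directly. By compactness \<open>q\<close> is a uniform limit of
  functions that depend on the first argument only through finitely many Borel pieces.\<close>

lemma continuous_measurable_pair:
  fixes q :: "'g \<Rightarrow> 'g \<Rightarrow> complex"
  assumes q: "continuous_on UNIV (\<lambda>z. q (fst z) (snd z))"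
  shows "(\<lambda>z. q (fst z) (snd z)) \<in> borel_measurable (M \<Otimes>\<^sub>M M)"
proof -
  have approx: "\<exists>s \<in> borel_measurable (M \<Otimes>\<^sub>M M). \<forall>z \<in> K \<times> K. dist (s z) (q (fst z) (snd z)) \<le> e"
    if "e > 0" for e
  proof -
    obtain X where X: "\<And>a. a \<in> X a" "\<And>a. open (X a)"
      "\<And>a x t. x \<in> X a \<Longrightarrow> t \<in> K \<Longrightarrow> dist (q x t) (q a t) \<le> e"
      using uniform_slices[OF q \<open>e > 0\<close>] by metis
    obtain C where C: "C \<subseteq> K" "finite C" "K \<subseteq> (\<Union>c\<in>C. X c)"
      by (rule compactE_image[OF compact_K, of K X]) (use X in auto)
    have "C \<noteq> {}" using C zero_in_K by auto
    \<comment> \<open>Enumerating the finite set \<open>C\<close> by all naturals, with repetitions,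
      lets the least index of a piece containing \<open>x\<close> serve as a measurable
      selector.\<close>
    define c where "c = from_nat_into C"
    have range_c: "range c = C"
      unfolding c_def by (simp add: range_from_nat_into \<open>C \<noteq> {}\<close> C(2) countable_finite)
    define idx where "idx x = (LEAST i. x \<in> X (c i))" for x
    have idx: "x \<in> X (c (idx x))" if "x \<in> K" for x
    proof -
      have "\<exists>i. x \<in> X (c i)" using C(3) range_c that by blast
      then show ?thesis unfolding idx_def by (rule LeastI_ex)
    qed
    have "{x \<in> space M. x \<in> X (c i)} \<in> sets M" for i
      using X(2)[of "c i"] by (auto simp: space_M sets_M sets_restrict_space Collect_conj_eq)
    then have [measurable]: "idx \<in> measurable M (count_space UNIV)"
      unfolding idx_def by (intro measurable_Least) (simp add: pred_def)
    have [measurable]: "q (c i) \<in> borel_measurable M" for i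
      by (rule continuous_measurable[OF continuous_slice[OF q]])
    have "(\<lambda>z. q (c (idx (fst z))) (snd z)) \<in> borel_measurable (M \<Otimes>\<^sub>M M)"
      by (rule measurable_compose_countable[where f = "\<lambda>i z. q (c i) (snd z)"]) measurable
    moreover have "dist (q (c (idx (fst z))) (snd z)) (q (fst z) (snd z)) \<le> e"
      if "z \<in> K \<times> K" for z
      using X(3)[OF idx, of "fst z" "snd z"] that by (auto simp: dist_commute)
    ultimately show ?thesis
      by (intro bexI[where x = "\<lambda>z. q (c (idx (fst z))) (snd z)"] ballI)
  qed
  have "\<exists>s \<in> borel_measurable (M \<Otimes>\<^sub>M M).
      \<forall>z \<in> K \<times> K. dist (s z) (q (fst z) (snd z)) \<le> inverse (real (Suc n))" for n
    by (rule approx) simp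
  then obtain s where s: "\<And>n. s n \<in> borel_measurable (M \<Otimes>\<^sub>M M)"
    "\<And>n z. z \<in> K \<times> K \<Longrightarrow> dist (s n z) (q (fst z) (snd z)) \<le> inverse (real (Suc n))"
    by metis
  show ?thesis
  proof (rule borel_measurable_LIMSEQ_metric[OF s(1)])
    fix z assume "z \<in> space (M \<Otimes>\<^sub>M M)"
    then have "z \<in> K \<times> K" by (simp add: space_pair_measure space_M)
    then have "dist (s n z) (q (fst z) (snd z)) \<le> dist (inverse (real (Suc n))) 0" for n
      using s(2)[of z n] by simp
    then show "(\<lambda>n. s n z) \<longlonglongrightarrow> q (fst z) (snd z)"
      by (intro metric_tendsto_imp_tendsto[OF LIMSEQ_inverse_real_of_nat] always_eventually allI)
  qed
qed

lemma integral_swap: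
  fixes q :: "'g \<Rightarrow> 'g \<Rightarrow> complex"
  assumes q: "continuous_on UNIV (\<lambda>z. q (fst z) (snd z))"
  shows "(\<integral>y. (\<integral>x. q x y \<partial>M) \<partial>M) = (\<integral>x. (\<integral>y. q x y \<partial>M) \<partial>M)"
proof -
  have "bounded ((\<lambda>z. q (fst z) (snd z)) ` (K \<times> K))"
    by (intro compact_imp_bounded compact_continuous_image compact_Times compact_K
        continuous_on_subset[OF q subset_UNIV])
  then obtain B where "\<And>z. z \<in> K \<times> K \<Longrightarrow> norm (q (fst z) (snd z)) \<le> B"
    unfolding bounded_iff by blast
  then have "integrable (M \<Otimes>\<^sub>M M) (\<lambda>z. q (fst z) (snd z))"
    by (intro pair.integrable_const_bound[where B = B] continuous_measurable_pair q AE_I2)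
       (auto simp: space_pair_measure space_M)
  then show ?thesis
    by (intro pair.Fubini_integral) (simp add: case_prod_beta')
qed

text \<open>Nearby slices are uniformly close on \<open>K\<close>, which has mass 1. The argument
  uses neighbourhoods because sequences need not determine continuity on an arbitrary parameter
  space.\<close>

lemma continuous_integral:
  fixes q :: "'a::topological_space \<Rightarrow> 'g \<Rightarrow> complex"
  assumes q: "continuous_on UNIV (\<lambda>z. q (fst z) (snd z))"
  shows "continuous_on UNIV (\<lambda>x. \<integral>k. q x k \<partial>M)"
proof -
  have int: "integrable M (q x)" for x
    by (rule continuous_integrable[OF continuous_slice[OF q]])
  have "((\<lambda>x. \<integral>k. q x k \<partial>M) \<longlongrightarrow> (\<integral>k. q a k \<partial>M)) (at a)" for a
  proof (rule tendstoI)
    fix e :: real assume "e > 0"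
    then obtain X where X: "a \<in> X" "open X" "\<And>x t. x \<in> X \<Longrightarrow> t \<in> K \<Longrightarrow> dist (q x t) (q a t) \<le> e/2"
      using uniform_slices[OF q, of "e/2" a] by auto
    have "dist (\<integral>k. q x k \<partial>M) (\<integral>k. q a k \<partial>M) < e" if "x \<in> X" for x
    proof -
      have "dist (\<integral>k. q x k \<partial>M) (\<integral>k. q a k \<partial>M) = norm (\<integral>k. q x k - q a k \<partial>M)"
        by (simp add: dist_norm int)
      also have "\<dots> \<le> (\<integral>k. norm (q x k - q a k) \<partial>M)"
        by (rule integral_norm_bound)
      also have "\<dots> \<le> e/2"
        by (rule integral_le_const) (use X(3)[OF that] in \<open>auto simp: int space_M dist_norm\<close>)
      finally show ?thesis using \<open>e > 0\<close> by simp
    qed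
    then show "\<forall>\<^sub>F x in at a. dist (\<integral>k. q x k \<partial>M) (\<integral>k. q a k \<partial>M) < e"
      using X by (auto simp: eventually_at_topological)
  qed
  then show ?thesis by (simp add: continuous_on_def)
qed

text \<open>Average p(h k^-1) over both variables: for fixed h, right invariance in k gives the left
  side; for fixed k, right invariance in h gives the right side. Fubini equates them.\<close>

lemma integral_reflect:
  fixes p :: "'g \<Rightarrow> complex"
  assumes p: "continuous_on UNIV p"
  shows "(\<integral>k. p (- k) \<partial>M) = (\<integral>k. p k \<partial>M)"
proof -
  have "(\<integral>k. p (- k) \<partial>M) = (\<integral>h. (\<integral>k. p (- (k + - h)) \<partial>M) \<partial>M)"
  proof -
    have "(\<integral>k. p (- (k + - h)) \<partial>M) = (\<integral>k. p (- k) \<partial>M)" if "h \<in> K" for h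
      by (rule integral_right_shift[where p = "\<lambda>k. p (- k)"])
         (use that in \<open>auto intro!: continuous_intros continuous_on_compose2[OF p] minus_in_K\<close>)
    then have "(\<integral>h. (\<integral>k. p (- (k + - h)) \<partial>M) \<partial>M) = (\<integral>h. (\<integral>k. p (- k) \<partial>M) \<partial>M)"
      by (rule Bochner_Integration.integral_cong[OF refl]) (simp only: space_M)
    then show ?thesis by (simp add: prob_space)
  qed
  also have "\<dots> = (\<integral>k. (\<integral>h. p (- (k + - h)) \<partial>M) \<partial>M)"
    by (rule integral_swap) (intro continuous_on_compose2[OF p] continuous_intros, auto)
  also have "\<dots> = (\<integral>k. (\<integral>h. p h \<partial>M) \<partial>M)"
  proof (rule Bochner_Integration.integral_cong[OF refl])
    fix k assume "k \<in> space M"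
    then show "(\<integral>h. p (- (k + - h)) \<partial>M) = (\<integral>h. p h \<partial>M)"
      using integral_right_shift[OF p, of "- k"] by (simp add: space_M minus_in_K)
  qed
  finally show ?thesis by (simp add: prob_space)
qed

section \<open>The averaged product and its algebra\<close>

text \<open>This is p(x \<star> y): \<open>p\<close> integrated against the convolution of the point
  mass at x with the law of k y k^-1. Partially applied, \<open>conv p x\<close> is the left
  translate of \<open>p\<close>.\<close>

definition conv :: "('g \<Rightarrow> complex) \<Rightarrow> 'g \<Rightarrow> 'g \<Rightarrow> complex" where
  "conv p x y = (\<integral>k. p (x + k + y + - k) \<partial>M)"

definition conj_inv :: "('g \<Rightarrow> complex) \<Rightarrow> bool" where
  "conj_inv p \<longleftrightarrow> (\<forall>k\<in>K. \<forall>x. p (k + x + - k) = p x)"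

lemma C_op_eq_conv: "C_op M f = conv f 0"
  by (simp add: fun_eq_iff C_op_def conv_def)

lemma continuous_conv_integrand:
  fixes p :: "'g \<Rightarrow> complex"
  assumes "continuous_on UNIV p"
  shows "continuous_on UNIV (\<lambda>k. p (x + k + y + - k))"
  by (intro continuous_on_compose2[OF assms] continuous_intros) auto

lemma conv_add:
  assumes "continuous_on UNIV p" "continuous_on UNIV q"
  shows "conv (\<lambda>u. p u + q u) x y = conv p x y + conv q x y"
  unfolding conv_def
  by (intro Bochner_Integration.integral_add continuous_integrable continuous_conv_integrand assms)

lemma conv_mult: "conv (\<lambda>u. c * p u) x y = c * conv p x y"
  by (simp add: conv_def)

lemma continuous_conv:
  assumes p: "continuous_on UNIV p"
  shows "continuous_on UNIV (conv p x)" "continuous_on UNIV (\<lambda>u. conv p u y)"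
  unfolding conv_def
  by (rule continuous_integral, intro continuous_on_compose2[OF p] continuous_intros, auto)+

text \<open>Conjugating y by a replaces the integration variable k by k a.\<close>

lemma conj_inv_conv:
  assumes p: "continuous_on UNIV p"
  shows "conj_inv (conv p x)"
  unfolding conj_inv_def
proof (intro ballI allI)
  fix a y assume "a \<in> K"
  then show "conv p x (a + y + - a) = conv p x y"
    using integral_right_shift[OF continuous_conv_integrand[OF p, of x y], of a]
    by (simp add: conv_def group_norm del: add_uminus_conv_diff)
qed

text \<open>Substituting k h for h turns y k^-1 h z h^-1 into y h z h^-1 k^-1, so the whole product
  y h z h^-1 is conjugated by k; Fubini then exchanges the two averages.\<close>

lemma conv_assoc:
  assumes p: "continuous_on UNIV p"
  shows "conv (conv p x) y z = conv (\<lambda>u. conv p u z) x y"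
proof -
  have "conv (\<lambda>u. conv p u z) x y = (\<integral>k. (\<integral>h. p (x + k + y + - k + h + z + - h) \<partial>M) \<partial>M)"
    by (simp add: conv_def)
  also have "\<dots> = (\<integral>k. (\<integral>h. p (x + k + (y + h + z + - h) + - k) \<partial>M) \<partial>M)"
  proof (rule Bochner_Integration.integral_cong[OF refl])
    fix k assume "k \<in> space M"
    then have "k \<in> K" by (simp add: space_M)
    from integral_left_shift[OF continuous_conv_integrand[OF p, of "x + k + y + - k" z] this]
    show "(\<integral>h. p (x + k + y + - k + h + z + - h) \<partial>M)
        = (\<integral>h. p (x + k + (y + h + z + - h) + - k) \<partial>M)"
      by (simp add: group_norm del: add_uminus_conv_diff)
  qed
  also have "\<dots> = (\<integral>h. (\<integral>k. p (x + k + (y + h + z + - h) + - k) \<partial>M) \<partial>M)"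
    by (rule integral_swap) (intro continuous_on_compose2[OF p] continuous_intros, auto)
  finally show ?thesis by (simp add: conv_def)
qed

text \<open>The inverse of x k y k^-1 is k y^-1 k^-1 x^-1. Invariance of \<open>p\<close> moves the
  leading k to the end, and \<open>integral_reflect\<close> replaces k by k^-1.\<close>

lemma conv_reflect:
  assumes p: "continuous_on UNIV p" and inv: "conj_inv p"
  shows "conv (\<lambda>u. p (- u)) x y = conv p (- y) (- x)"
proof -
  have "conv (\<lambda>u. p (- u)) x y = (\<integral>k. p (- y + - k + - x + - (- k)) \<partial>M)"
    unfolding conv_def
  proof (rule Bochner_Integration.integral_cong[OF refl])
    fix k assume "k \<in> space M"
    then have "k \<in> K" by (simp add: space_M)
    then have "p (k + (- y + - k + - x + - (- k)) + - k) = p (- y + - k + - x + - (- k))"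
      using inv unfolding conj_inv_def by blast
    then show "p (- (x + k + y + - k)) = p (- y + - k + - x + - (- k))"
      by (simp add: group_norm del: add_uminus_conv_diff)
  qed
  also have "\<dots> = conv p (- y) (- x)"
    unfolding conv_def
    by (rule integral_reflect[OF continuous_conv_integrand[OF p]])
  finally show ?thesis .
qed

lemma conv_zero_right: "conv p x 0 = p x"
  by (simp add: conv_def group_norm prob_space)

lemma conv_zero_left:
  assumes "conj_inv p"
  shows "conv p 0 y = p y"
proof -
  have "conv p 0 y = (\<integral>k. p y \<partial>M)"
    unfolding conv_def using assms
    by (intro Bochner_Integration.integral_cong) (auto simp: space_M conj_inv_def)
  then show ?thesis by (simp add: prob_space)
qed

end

section \<open>The linear space of solutions for fixed \<open>\<mu>\<close> and
  \<open>g\<close>\<close>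

locale wilson_equation = compact_haar K M
  for K :: "'g::{topological_group_add, t2_space} set" and M :: "'g measure" +
  fixes \<mu> g :: "'g \<Rightarrow> complex"
  assumes char: "continuous_character \<mu>"
begin

lemma cont_mu: "continuous_on UNIV \<mu>"
  and mu_nz: "\<mu> x \<noteq> 0"
  and mu_add: "\<mu> (x + y) = \<mu> x * \<mu> y"
  using char by (auto simp: continuous_character_def)

lemma mu_zero: "\<mu> 0 = 1"
  using mu_add[of 0 0] mu_nz[of 0] by simp

lemma mu_minus: "\<mu> (- x) = inverse (\<mu> x)"
  using mu_add[of x "- x"] mu_nz[of x] by (simp add: mu_zero field_simps)

lemma mu_conj: "\<mu> (x + k + y + - k) = \<mu> x * \<mu> y"
  by (simp add: mu_add mu_minus mu_nz del: add_uminus_conv_diff)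

lemma conv_mu_mult: "conv (\<lambda>u. \<mu> u * p u) x y = \<mu> x * \<mu> y * conv p x y"
  by (simp add: conv_def mu_conj del: add_uminus_conv_diff)

definition solution :: "('g \<Rightarrow> complex) \<Rightarrow> bool" where
  "solution f \<longleftrightarrow> continuous_on UNIV f \<and>
     (\<forall>x y. conv f x y + \<mu> y * conv f x (- y) = 2 * f x * g y)"

lemma solution_cont: "solution f \<Longrightarrow> continuous_on UNIV f"
  and solution_eq: "solution f \<Longrightarrow> conv f x y + \<mu> y * conv f x (- y) = 2 * f x * g y"
  by (auto simp: solution_def)

text \<open>Translation acts from the left and the equation from the right, so by
  \<open>conv_assoc\<close> they commute.\<close>

lemma solution_translate:
  assumes f: "solution f"
  shows "solution (conv f w)"
proof -
  note c = solution_cont[OF f]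
  have "conv (conv f w) x y + \<mu> y * conv (conv f w) x (- y) = 2 * conv f w x * g y" for x y
  proof -
    have "conv (conv f w) x y + \<mu> y * conv (conv f w) x (- y)
        = conv (\<lambda>u. conv f u y + \<mu> y * conv f u (- y)) w x"
      by (simp add: conv_assoc[OF c] conv_add conv_mult continuous_conv[OF c] continuous_intros)
    also have "\<dots> = conv (\<lambda>u. (2 * g y) * f u) w x"
      by (simp add: solution_eq[OF f] mult_ac)
    also have "\<dots> = 2 * g y * conv f w x" by (rule conv_mult)
    finally show ?thesis by (simp add: mult_ac)
  qed
  then show ?thesis by (simp add: solution_def continuous_conv[OF c])
qed

lemma solution_add:
  assumes "solution p" "solution q"
  shows "solution (\<lambda>u. p u + q u)"
  unfolding solution_def
proof (intro conjI allI)
  fix x y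
  show "conv (\<lambda>u. p u + q u) x y + \<mu> y * conv (\<lambda>u. p u + q u) x (- y) = 2 * (p x + q x) * g y"
    using solution_eq[OF assms(1), of x y] solution_eq[OF assms(2), of x y]
    by (simp add: conv_add solution_cont assms algebra_simps)
qed (intro continuous_intros solution_cont assms)

lemma solution_mult:
  assumes "solution p"
  shows "solution (\<lambda>u. c * p u)"
  unfolding solution_def
proof (intro conjI allI)
  fix x y
  show "conv (\<lambda>u. c * p u) x y + \<mu> y * conv (\<lambda>u. c * p u) x (- y) = 2 * (c * p x) * g y"
    using arg_cong[OF solution_eq[OF assms, of x y], of "\<lambda>t. c * t"]
    by (simp add: conv_mult algebra_simps)
qed (intro continuous_intros solution_cont assms)

section \<open>Defects of the equation and their symmetries\<close>

definition defect :: "'g \<Rightarrow> 'g \<Rightarrow> complex" where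
  "defect x y = conv g x y + \<mu> y * conv g x (- y) - 2 * g x * g y"

text \<open>Putting y on the left makes this, as a function of x, a linear combination of
  \<open>f\<close> and its left translates, hence a solution whenever \<open>f\<close> is
  one.\<close>

definition left_defect :: "('g \<Rightarrow> complex) \<Rightarrow> 'g \<Rightarrow> 'g \<Rightarrow> complex" where
  "left_defect f y x = conv f y x + \<mu> y * conv f (- y) x - 2 * g y * f x"

lemma solution_left_defect:
  assumes "solution f"
  shows "solution (left_defect f y)"
proof -
  have "left_defect f y = (\<lambda>x. (conv f y x + \<mu> y * conv f (- y) x) + (- 2 * g y) * f x)"
    by (simp add: fun_eq_iff left_defect_def)
  then show ?thesis
    by (simp only:) (intro solution_add solution_mult solution_translate assms)
qed

text \<open>At first argument 0 the equation expresses \<open>g\<close> by the even part of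
  \<open>f\<close>. Averaging this (\<open>A\<close>) at (x, y) and (x, -y) produces the terms of
  \<open>defect\<close>; the equation at (x, y), (y, x) and (-y, x) eliminates the reversed
  products.\<close>

lemma left_defect_eq:
  assumes f: "solution f" and inv: "conj_inv f"
  shows "left_defect f y x = - 2 * f 0 * defect x y"
proof -
  note c = solution_cont[OF f]
  have even: "f u + \<mu> u * f (- u) = 2 * f 0 * g u" for u
    using solution_eq[OF f, of 0 u] by (simp add: conv_zero_left[OF inv])
  have A: "conv f a b + \<mu> a * \<mu> b * conv f (- b) (- a) = 2 * f 0 * conv g a b" for a b
  proof -
    have "conv f a b + \<mu> a * \<mu> b * conv f (- b) (- a) = conv (\<lambda>u. f u + \<mu> u * f (- u)) a b"
      by (subst conv_add)
         (auto simp: conv_mu_mult conv_reflect[OF c inv] intro!: c continuous_intros cont_mu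
           continuous_on_compose2[OF c])
    also have "\<dots> = 2 * f 0 * conv g a b"
      by (simp only: even conv_mult)
    finally show ?thesis .
  qed
  have 1: "conv f x y + \<mu> x * \<mu> y * conv f (- y) (- x) = 2 * f 0 * conv g x y"
    by (rule A)
  have "\<mu> y * \<mu> (- y) = 1"
    by (simp add: mu_minus mu_nz)
  then have 2: "\<mu> y * conv f x (- y) + \<mu> x * conv f y (- x) = 2 * f 0 * (\<mu> y * conv g x (- y))"
    using A[of x "- y", unfolded minus_minus] by algebra
  have 3: "\<mu> y * (conv f (- y) x + \<mu> x * conv f (- y) (- x)) = \<mu> y * (2 * f (- y) * g x)"
    using solution_eq[OF f, of "- y" x] by simp
  have 4: "2 * g x * (f y + \<mu> y * f (- y)) = 2 * g x * (2 * f 0 * g y)"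
    by (simp only: even)
  show ?thesis
    using 1 2 3 4 solution_eq[OF f, of x y] solution_eq[OF f, of y x]
    unfolding left_defect_def defect_def by algebra
qed

lemma left_defect_odd:
  assumes f: "solution f" and inv: "conj_inv f"
  shows "\<mu> x * left_defect f y (- x) = - left_defect f y x"
proof -
  have even: "f u + \<mu> u * f (- u) = 2 * f 0 * g u" for u
    using solution_eq[OF f, of 0 u] by (simp add: conv_zero_left[OF inv])
  show ?thesis
    using solution_eq[OF f, of y x] solution_eq[OF f, of "- y" x] even[of x] even[of y]
    unfolding left_defect_def by algebra
qed

text \<open>For odd \<open>h\<close>, inversion reverses products of two or three factors up to a
  sign and values of \<open>\<mu>\<close>. The word x y x is a palindrome, so only the signs of x
  and y change, and the two y-terms trade places.\<close>

lemma left_defect_reflect: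
  assumes h: "solution h" and inv: "conj_inv h" and odd: "\<And>u. \<mu> u * h (- u) = - h u"
  shows "left_defect (conv h x) y x = - (\<mu> x)\<^sup>2 * left_defect (conv h (- x)) y (- x)"
proof -
  note c = solution_cont[OF h]
  have two: "conv h a b = - \<mu> a * \<mu> b * conv h (- b) (- a)" for a b
  proof -
    have "conv h a b = conv (\<lambda>u. (- 1) * (\<mu> u * h (- u))) a b"
      by (simp add: odd)
    also have "\<dots> = - \<mu> a * \<mu> b * conv h (- b) (- a)"
      by (simp only: conv_mult conv_mu_mult conv_reflect[OF c inv]) simp
    finally show ?thesis .
  qed
  have three: "conv (conv h a) b d = - \<mu> a * \<mu> b * \<mu> d * conv (conv h (- d)) (- b) (- a)" for a b d
  proof -
    have "conv (conv h a) b d = conv (\<lambda>u. (- \<mu> d) * (\<mu> u * conv h (- d) (- u))) a b"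
      unfolding conv_assoc[OF c] by (subst two) (simp add: mult_ac)
    also have "\<dots> = - \<mu> a * \<mu> b * \<mu> d * conv (conv h (- d)) (- b) (- a)"
      by (simp only: conv_mult conv_mu_mult
          conv_reflect[OF continuous_conv(1)[OF c] conj_inv_conv[OF c]]) simp
    finally show ?thesis .
  qed
  show ?thesis
    unfolding left_defect_def using three[of x y x] three[of x "- y" x] two[of x x] mu_nz[of y]
    by (simp add: mu_minus field_simps power2_eq_square)
qed

section \<open>Vanishing of the defect\<close>

lemma defect_zero:
  assumes f: "solution f" and nz: "conv f 0 \<noteq> (\<lambda>x. 0)"
  shows "defect x y = 0"
proof -
  obtain w where w: "conv f 0 w \<noteq> 0" using nz by auto
  \<comment> \<open>A translate by w takes at 0 the value of the original function at w, so this
    moves the nonzero value to the identity; being a translate, \<open>q\<close> is also conjugation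
    invariant.\<close>
  define q where "q = conv (conv f 0) w"
  have sol_q: "solution q" and inv_q: "conj_inv q"
    unfolding q_def by (intro solution_translate conj_inv_conv solution_cont f)+
  have q0: "q 0 \<noteq> 0" using w by (simp add: q_def conv_zero_right)
  define h where "h = left_defect q y"
  have h_eq: "h u = - 2 * q 0 * defect u y" for u
    unfolding h_def by (rule left_defect_eq[OF sol_q inv_q])
  have sol_h: "solution h" unfolding h_def by (rule solution_left_defect[OF sol_q])
  have inv_h: "conj_inv h"
    using conj_inv_conv[OF solution_cont[OF sol_q]] inv_q
    unfolding h_def conj_inv_def left_defect_def by simp
  have odd_h: "\<mu> u * h (- u) = - h u" for u
    unfolding h_def by (rule left_defect_odd[OF sol_q inv_q])
  \<comment> \<open>The translate \<open>conv h u\<close> has value \<open>h u\<close> at 0. As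
    \<open>h u\<close> is itself a multiple of \<open>defect u y\<close>, the right side is a
    multiple of a square.\<close>
  have L: "left_defect (conv h u) y u = - 2 * h u * defect u y" for u
    by (subst left_defect_eq)
       (auto intro!: solution_translate conj_inv_conv solution_cont sol_h simp: conv_zero_right)
  have "q 0 * left_defect (conv h u) y u = (h u)\<^sup>2" for u
    unfolding L h_eq by (simp add: power2_eq_square)
  \<comment> \<open>This is the reflection identity multiplied by \<open>q 0\<close>. Oddness turns
    its right side into minus the square of \<open>h x\<close>.\<close>
  then have "(h x)\<^sup>2 = - (\<mu> x * h (- x))\<^sup>2"
    using left_defect_reflect[OF sol_h inv_h odd_h, of x y]
    by (metis (no_types, lifting) mult.left_commute mult_minus_left power_mult_distrib)
  then have "h x = 0"
    unfolding odd_h by simp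
  then show ?thesis using q0 by (simp add: h_eq)
qed

end

theorem theorem2p3:
  fixes K :: "'g::{topological_group_add, t2_space} set"
    and M :: "'g measure"
    and \<mu> f g :: "'g \<Rightarrow> complex"
  assumes "locally_compact_space (euclidean :: 'g topology)"
    and "compact_subgroup K"
    and "normalized_haar K M"
    and "continuous_character \<mu>"
    and "continuous_on UNIV f" and "continuous_on UNIV g"
    and "\<forall>x y. (\<integral>k. f (x + k + y + - k) \<partial>M) + \<mu> y * (\<integral>k. f (x + k + - y + - k) \<partial>M)
                = 2 * f x * g y"
    and "C_op M f \<noteq> (\<lambda>x. 0)"
  shows "\<forall>x y. (\<integral>k. g (x + k + y + - k) \<partial>M) + \<mu> y * (\<integral>k. g (x + k + - y + - k) \<partial>M)
                = 2 * g x * g y"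
proof -
  interpret wilson_equation K M \<mu> g
    using assms by unfold_locales
  have "solution f"
    using assms(5,7) unfolding solution_def conv_def by blast
  moreover have "conv f 0 \<noteq> (\<lambda>x. 0)"
    using assms(8) by (simp only: C_op_eq_conv not_False_eq_True)
  ultimately have "defect x y = 0" for x y
    by (rule defect_zero)
  then show ?thesis
    by (simp only: defect_def conv_def right_minus_eq) blast
qed

end
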